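(* For every bivariate copula $C$, $$\mu_1(C)\;\le\;\frac{\sigma_1(C)}{6}\;\le\;\frac{2-|\rho(C)|}{6}.$$
   Context: A (bivariate) copula is a function $C:[0,1]^2\to[0,1]$ with $C(t,0)=C(0,t)=0$, $C(t,1)=C(1,t)=t$ for all $t\in[0,1]$, and $C(u',v')-C(u,v')-C(u',v)+C(u,v)\ge 0$ whenever $u\le u'$, $v\le v'$ in $[0,1]$. Notation: $\mu_1(C)=\int_{[0,1]^2}|C(u,v)-C(v,u)|\,du\,dv$; $\sigma_1(C)=12\int_{[0,1]^2}|C(u,v)-uv|\,du\,dv$ (Schweizer–Wolff measure with $p=1$); $\rho(C)=12\int_{[0,1]^2}C(u,v)\,du\,dv-3$ (Spearman's $\rho$). *)

theory Defs
  imports "HOL-Analysis.Analysis"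
begin

text \<open>
  A copula on the unit square is represented by a total curried function of which only the values
  on \<open>{0..1} \<times> {0..1}\<close> are constrained; the integrals below likewise only use
  those values.
\<close>

definition copula :: "(real \<Rightarrow> real \<Rightarrow> real) \<Rightarrow> bool" where
  "copula C \<longleftrightarrow>
     (\<forall>u\<in>{0..1}. \<forall>v\<in>{0..1}. C u v \<in> {0..1}) \<and>
     (\<forall>t\<in>{0..1}. C t 0 = 0 \<and> C 0 t = 0 \<and> C t 1 = t \<and> C 1 t = t) \<and>
     (\<forall>u\<in>{0..1}. \<forall>u'\<in>{0..1}. \<forall>v\<in>{0..1}. \<forall>v'\<in>{0..1}.
        u \<le> u' \<longrightarrow> v \<le> v' \<longrightarrow> C u' v' - C u v' - C u' v + C u v \<ge> 0)"

definition mu1 :: "(real \<Rightarrow> real \<Rightarrow> real) \<Rightarrow> real" where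
  "mu1 C = set_lebesgue_integral lborel ({0..1} \<times> {0..1}) (\<lambda>(u, v). \<bar>C u v - C v u\<bar>)"

definition sigma1 :: "(real \<Rightarrow> real \<Rightarrow> real) \<Rightarrow> real" where
  "sigma1 C =
     12 * set_lebesgue_integral lborel ({0..1} \<times> {0..1}) (\<lambda>(u, v). \<bar>C u v - u * v\<bar>)"

definition spearman_rho :: "(real \<Rightarrow> real \<Rightarrow> real) \<Rightarrow> real" where
  "spearman_rho C =
     12 * set_lebesgue_integral lborel ({0..1} \<times> {0..1}) (\<lambda>(u, v). C u v) - 3"

end

theory Submission
  imports Defs
begin

text \<open>
  The first inequality is the triangle inequality through \<open>u * v\<close>, integrated, since the
  reflection \<open>(u, v) \<mapsto> (v, u)\<close> preserves the integral.  For the second, the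
  Frechet--Hoeffding bounds \<open>max 0 (u + v - 1) \<le> C u v \<le> min u v\<close> bound both the positive
  and the negative part of \<open>C u v - u * v\<close> by functions whose integral is \<open>1 / 12\<close>, and
  \<open>\<bar>x\<bar> + x\<close>, \<open>\<bar>x\<bar> - x\<close> are twice these parts.
\<close>

text \<open>Bridge from the Lebesgue integrals of the definitions to the gauge integral, in which
  the computations below are done: a continuous function on a compact set is Lebesgue integrable,
  and then both integrals agree.\<close>

lemma set_integral_unit_square:
  fixes f :: "real \<times> real \<Rightarrow> real"
  assumes "continuous_on ({0..1} \<times> {0..1}) f"
  shows "set_lebesgue_integral lborel ({0..1} \<times> {0..1}) f = integral ({0..1} \<times> {0..1}) f"
proof -
  have "set_integrable lborel ({0..1} \<times> {0..1}) f"
    unfolding set_integrable_def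
    using assms by (intro borel_integrable_compact compact_Times) auto
  then show ?thesis
    by (rule set_borel_integral_eq_integral)
qed

lemma integrable_on_unit_square:
  fixes f :: "real \<times> real \<Rightarrow> real"
  assumes "continuous_on ({0..1} \<times> {0..1}) f"
  shows "f integrable_on ({0..1} \<times> {0..1})"
  using integrable_continuous[of "(0, 0)" "(1, 1)" f] assms by (simp add: cbox_Pair_eq)

lemma integral_unit_square_iterated:
  fixes f :: "real \<times> real \<Rightarrow> real"
  assumes "continuous_on ({0..1} \<times> {0..1}) f"
  shows "integral ({0..1} \<times> {0..1}) f = integral {0..1} (\<lambda>u. integral {0..1} (\<lambda>v. f (u, v)))"
  using integral_prod_continuous[of 0 0 1 1 f] assms by (simp add: cbox_Pair_eq)

lemma continuous_on_unit_square_swap: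
  fixes f :: "real \<times> real \<Rightarrow> real"
  assumes "continuous_on ({0..1} \<times> {0..1}) f"
  shows "continuous_on ({0..1} \<times> {0..1}) (\<lambda>p. f (snd p, fst p))"
  by (rule continuous_on_compose2[OF assms]) (auto intro!: continuous_intros)

lemma integral_unit_square_swap:
  fixes f :: "real \<times> real \<Rightarrow> real"
  assumes "continuous_on ({0..1} \<times> {0..1}) f"
  shows "integral ({0..1} \<times> {0..1}) (\<lambda>p. f (snd p, fst p)) = integral ({0..1} \<times> {0..1}) f"
  using integral_swap_continuous[of 0 0 1 1 "\<lambda>u v. f (u, v)"] assms
  by (simp add: integral_unit_square_iterated[OF assms]
      integral_unit_square_iterated[OF continuous_on_unit_square_swap[OF assms]] cbox_Pair_eq)

text \<open>Fubini as a computation rule: \<open>g\<close> is an explicit antiderivative-based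
  formula for the sections, and two one-dimensional facts then give the double integral.\<close>

lemma integral_square:
  fixes f :: "real \<times> real \<Rightarrow> real"
  assumes cont: "continuous_on ({0..1} \<times> {0..1}) f"
    and inner: "\<And>u. u \<in> {0..1} \<Longrightarrow> ((\<lambda>v. f (u, v)) has_integral g u) {0..1}"
    and outer: "(g has_integral c) {0..1}"
  shows "integral ({0..1} \<times> {0..1}) f = c"
proof -
  have "integral {0..1} (\<lambda>u. integral {0..1} (\<lambda>v. f (u, v))) = integral {0..1} g"
    by (rule integral_cong) (use inner in blast)
  then show ?thesis
    using outer by (simp add: integral_unit_square_iterated[OF cont] integral_unique)
qed

lemma fundamental_theorem_of_calculus_real:
  fixes F F' :: "real \<Rightarrow> real"
  assumes "a \<le> b" "\<And>x. x \<in> {a..b} \<Longrightarrow> (F has_real_derivative F' x) (at x)"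
  shows "(F' has_integral F b - F a) {a..b}"
  using assms
  by (intro fundamental_theorem_of_calculus)
    (simp_all add: has_field_derivative_at_within flip: has_real_derivative_iff_has_vector_derivative)

text \<open>Sections of both Frechet-Hoeffding bounds reduce to this function. It vanishes up to
  \<open>a\<close> and is linear afterwards.\<close>

lemma has_integral_positive_part_shift:
  fixes a :: real
  assumes "a \<in> {0..1}"
  shows "((\<lambda>v. max 0 (v - a)) has_integral (1 - a)\<^sup>2 / 2) {0..1}"
proof -
  have "((\<lambda>v. 0) has_integral 0) {0..a}"
    by simp
  then have left: "((\<lambda>v. max 0 (v - a)) has_integral 0) {0..a}"
    by (rule has_integral_eq[rotated]) auto
  have "((\<lambda>v. v - a) has_integral (1 - a)\<^sup>2 / 2 - (a - a)\<^sup>2 / 2) {a..1}"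
    by (rule fundamental_theorem_of_calculus_real[where F = "\<lambda>v. (v - a)\<^sup>2 / 2"])
      (use assms in \<open>auto intro!: derivative_eq_intros\<close>)
  then have right: "((\<lambda>v. max 0 (v - a)) has_integral (1 - a)\<^sup>2 / 2) {a..1}"
    by (subst has_integral_cong[where g = "\<lambda>v. v - a"]) auto
  show ?thesis
    using has_integral_combine[OF _ _ left right] assms by simp
qed

lemma integral_product_unit_square:
  "integral ({0..1} \<times> {0..1}) (\<lambda>p::real \<times> real. fst p * snd p) = 1 / 4"
proof (rule integral_square)
  show "((\<lambda>v::real. fst (u, v) * snd (u, v)) has_integral u / 2) {0..1}" for u :: real
    using has_integral_mult_right[OF ident_has_integral[of 0 "1::real"], of u] by simp
  show "((\<lambda>u::real. u / 2) has_integral 1 / 4) {0..1}"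
    using has_integral_divide[OF ident_has_integral[of 0 "1::real"], of 2] by simp
qed (intro continuous_intros)

lemma integral_upper_Frechet_bound:
  "integral ({0..1} \<times> {0..1}) (\<lambda>p::real \<times> real. min (fst p) (snd p)) = 1 / 3"
proof (rule integral_square)
  show "((\<lambda>v. min (fst (u, v)) (snd (u, v))) has_integral 1 / 2 - (1 - u)\<^sup>2 / 2) {0..1}"
    if "u \<in> {0..1}" for u :: real
  \<comment> \<open>\<open>min u v = v - max 0 (v - u)\<close>.\<close>
  proof (rule has_integral_eq)
    show "((\<lambda>v. v - max 0 (v - u)) has_integral 1 / 2 - (1 - u)\<^sup>2 / 2) {0..1}"
      using has_integral_diff[OF ident_has_integral[of 0 "1::real"]
          has_integral_positive_part_shift[OF that]] by simp
  qed auto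
  have "((\<lambda>u::real. 1 / 2 - (1 - u)\<^sup>2 / 2) has_integral
      (1 / 2 + (1 - 1) ^ 3 / 6 - (0 / 2 + (1 - 0) ^ 3 / 6))) {0..1}"
    by (rule fundamental_theorem_of_calculus_real[where F = "\<lambda>u. u / 2 + (1 - u) ^ 3 / 6"])
      (auto intro!: derivative_eq_intros)
  then show "((\<lambda>u::real. 1 / 2 - (1 - u)\<^sup>2 / 2) has_integral 1 / 3) {0..1}"
    by simp
qed (intro continuous_intros)

lemma integral_lower_Frechet_bound:
  "integral ({0..1} \<times> {0..1}) (\<lambda>p::real \<times> real. max 0 (fst p + snd p - 1)) = 1 / 6"
proof (rule integral_square)
  show "((\<lambda>v. max 0 (fst (u, v) + snd (u, v) - 1)) has_integral u\<^sup>2 / 2) {0..1}"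
    \<comment> \<open>The section is \<open>max 0 (v - a)\<close> with
      \<open>a = 1 - u\<close>.\<close>
    if "u \<in> {0..1}" for u :: real
    using has_integral_positive_part_shift[of "1 - u"] that by (simp add: algebra_simps)
  have "((\<lambda>u::real. u\<^sup>2 / 2) has_integral 1 ^ 3 / 6 - 0 ^ 3 / 6) {0..1}"
    by (rule fundamental_theorem_of_calculus_real[where F = "\<lambda>u. u ^ 3 / 6"])
      (auto intro!: derivative_eq_intros)
  then show "((\<lambda>u::real. u\<^sup>2 / 2) has_integral 1 / 6) {0..1}"
    by simp
qed (intro continuous_intros)

text \<open>Each bound is the nonnegative mass of a rectangle with a corner at
  \<open>(u, v)\<close>: [u,1] x [v,1] gives the lower one, [0,u] x [v,1] and [u,1] x [0,v] give
  \<open>C u v \<le> u\<close> and \<open>C u v \<le> v\<close>.\<close>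

lemma copula_Frechet_bounds:
  assumes "copula C" "u \<in> {0..1}" "v \<in> {0..1}"
  shows "max 0 (u + v - 1) \<le> C u v" "C u v \<le> min u v"
proof -
  have bounds: "C u v \<in> {0..1}"
    and margins: "\<And>t. t \<in> {0..1} \<Longrightarrow> C t 0 = 0 \<and> C 0 t = 0 \<and> C t 1 = t \<and> C 1 t = t"
    and incr: "\<And>u u' v v'. \<lbrakk>u \<in> {0..1}; u' \<in> {0..1}; v \<in> {0..1}; v' \<in> {0..1}; u \<le> u'; v \<le> v'\<rbrakk>
      \<Longrightarrow> C u' v' - C u v' - C u' v + C u v \<ge> 0"
    using assms unfolding copula_def by blast+
  show "max 0 (u + v - 1) \<le> C u v"
    using incr[of u 1 v 1] margins[of u] margins[of v] margins[of 1] bounds assms by auto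
  show "C u v \<le> min u v"
    using incr[of 0 u v 1] incr[of u 1 0 v] margins[of u] margins[of v] margins[of 0] margins[of 1]
      assms by auto
qed

text \<open>Monotonicity is the nonnegative mass of [u,u'] x [0,v], the Lipschitz bound that of
  [u,u'] x [v,1].\<close>

lemma copula_increment_fst:
  assumes "copula C" "u \<in> {0..1}" "u' \<in> {0..1}" "v \<in> {0..1}" "u \<le> u'"
  shows "C u v \<le> C u' v" "C u' v - C u v \<le> u' - u"
proof -
  have margins: "\<And>t. t \<in> {0..1} \<Longrightarrow> C t 0 = 0 \<and> C t 1 = t"
    and incr: "\<And>v v'. \<lbrakk>v \<in> {0..1}; v' \<in> {0..1}; v \<le> v'\<rbrakk>
      \<Longrightarrow> C u' v' - C u v' - C u' v + C u v \<ge> 0"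
    using assms unfolding copula_def by blast+
  show "C u v \<le> C u' v" "C u' v - C u v \<le> u' - u"
    using incr[of 0 v] incr[of v 1] margins[of u] margins[of u'] assms by auto
qed

text \<open>Transfers the estimates in the first argument to the second.\<close>

lemma copula_swap:
  assumes "copula C"
  shows "copula (\<lambda>u v. C v u)"
proof -
  have "C v' u' - C v' u - C v u' + C v u \<ge> 0"
    if "u \<in> {0..1}" "u' \<in> {0..1}" "v \<in> {0..1}" "v' \<in> {0..1}" "u \<le> u'" "v \<le> v'" for u u' v v'
  proof -
    have "C v' u' - C v u' - C v' u + C v u \<ge> 0"
      using assms that unfolding copula_def by blast
    then show ?thesis by linarith
  qed
  with assms show ?thesis
    unfolding copula_def by simp
qed

lemma copula_Lipschitz_fst:
  assumes "copula C" "u \<in> {0..1}" "u' \<in> {0..1}" "v \<in> {0..1}"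
  shows "\<bar>C u' v - C u v\<bar> \<le> \<bar>u' - u\<bar>"
  using copula_increment_fst[of C u u' v] copula_increment_fst[of C u' u v] assms
  by (cases "u \<le> u'") auto

text \<open>\<open>C\<close> is 1-Lipschitz in each argument, so moving one coordinate at a time
  changes it by at most twice the distance; hence the radius \<open>e / 2\<close>. This makes all
  integrands below integrable.\<close>

lemma copula_continuous_on:
  assumes "copula C"
  shows "continuous_on ({0..1} \<times> {0..1}) (\<lambda>p. C (fst p) (snd p))"
proof (rule continuous_onI)
  fix p :: "real \<times> real" and e :: real
  assume p: "p \<in> {0..1} \<times> {0..1}" and e: "e > 0"
  have "dist (C (fst q) (snd q)) (C (fst p) (snd p)) \<le> e"
    if q: "q \<in> {0..1} \<times> {0..1}" and close: "dist q p < e / 2" for q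
  proof -
    have "\<bar>C (fst q) (snd q) - C (fst p) (snd q)\<bar> \<le> \<bar>fst q - fst p\<bar>"
      using p q by (intro copula_Lipschitz_fst assms) auto
    moreover have "\<bar>C (fst p) (snd q) - C (fst p) (snd p)\<bar> \<le> \<bar>snd q - snd p\<bar>"
      using p q by (intro copula_Lipschitz_fst[OF copula_swap[OF assms]]) auto
    moreover have "\<bar>fst q - fst p\<bar> \<le> dist q p" "\<bar>snd q - snd p\<bar> \<le> dist q p"
      using dist_fst_le[of q p] dist_snd_le[of q p] by (auto simp: dist_real_def)
    ultimately show ?thesis
      using close by (simp add: dist_real_def)
  qed
  with e show "\<exists>d>0. \<forall>q\<in>{0..1} \<times> {0..1}. dist q p < d
      \<longrightarrow> dist (C (fst q) (snd q)) (C (fst p) (snd p)) \<le> e"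
    by (intro exI[of _ "e / 2"]) auto
qed

theorem proposition2:
  fixes C :: "real \<Rightarrow> real \<Rightarrow> real"
  assumes "copula C"
  shows "mu1 C \<le> sigma1 C / 6 \<and> sigma1 C / 6 \<le> (2 - \<bar>spearman_rho C\<bar>) / 6"
proof -
  \<comment> \<open>\<open>b\<close> is the transpose of the copula \<open>c\<close>,
    \<open>m\<close> the independence copula, \<open>M\<close> and \<open>W\<close> the upper and
    lower Frechet-Hoeffding bounds.\<close>
  define S :: "(real \<times> real) set" where "S = {0..1} \<times> {0..1}"
  define c where "c = (\<lambda>p. C (fst p) (snd p))"
  define b where "b = (\<lambda>p. C (snd p) (fst p))"
  define m where "m = (\<lambda>p::real \<times> real. fst p * snd p)"
  define M where "M = (\<lambda>p::real \<times> real. min (fst p) (snd p))"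
  define W where "W = (\<lambda>p::real \<times> real. max 0 (fst p + snd p - 1))"
  have cont [continuous_intros]:
    "continuous_on S c" "continuous_on S b" "continuous_on S m" "continuous_on S M" "continuous_on S W"
    using copula_continuous_on[OF assms] copula_continuous_on[OF copula_swap[OF assms]]
    unfolding S_def c_def b_def m_def M_def W_def by (auto intro!: continuous_intros)
  have int: "f integrable_on S" if "continuous_on S f" for f :: "real \<times> real \<Rightarrow> real"
    using that unfolding S_def by (rule integrable_on_unit_square)
  have mu: "mu1 C = integral S (\<lambda>p. \<bar>c p - b p\<bar>)"
  proof -
    have "continuous_on S (\<lambda>p. \<bar>c p - b p\<bar>)" by (intro continuous_intros)
    from set_integral_unit_square[OF this[unfolded S_def]] show ?thesis
      by (simp add: mu1_def c_def b_def S_def case_prod_beta')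
  qed
  have cont_D: "continuous_on S (\<lambda>p. \<bar>c p - m p\<bar>)" by (intro continuous_intros)
  have sigma: "sigma1 C = 12 * integral S (\<lambda>p. \<bar>c p - m p\<bar>)"
    using set_integral_unit_square[OF cont_D[unfolded S_def]]
    by (simp add: sigma1_def c_def m_def S_def case_prod_beta')
  have rho: "spearman_rho C = 12 * integral S c - 3"
    using set_integral_unit_square[OF cont(1)[unfolded S_def]]
    by (simp add: spearman_rho_def c_def S_def case_prod_beta')
  \<comment> \<open>As \<open>m\<close> is symmetric, the left integrand is the reflection of the
    right one.\<close>
  have swap: "integral S (\<lambda>p. \<bar>b p - m p\<bar>) = integral S (\<lambda>p. \<bar>c p - m p\<bar>)"
    using integral_unit_square_swap[OF cont_D[unfolded S_def]]
    by (simp add: c_def b_def m_def S_def mult.commute)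
  have "integral S (\<lambda>p. \<bar>c p - b p\<bar>) \<le> integral S (\<lambda>p. \<bar>c p - m p\<bar> + \<bar>b p - m p\<bar>)"
    by (intro integral_le int continuous_intros) auto
  also have "\<dots> = integral S (\<lambda>p. \<bar>c p - m p\<bar>) + integral S (\<lambda>p. \<bar>b p - m p\<bar>)"
    by (intro integral_add int continuous_intros)
  finally have first: "mu1 C \<le> sigma1 C / 6"
    using mu sigma swap by simp

  have pt: "m p \<le> M p" "W p \<le> m p" "c p \<le> M p" "W p \<le> c p" if "p \<in> S" for p
  proof -
    have "fst p \<in> {0..1}" "snd p \<in> {0..1}"
      using that by (auto simp: S_def)
    \<comment> \<open>Expanded, this is \<open>u + v - 1 \<le> u * v\<close>, the nontrivial half of
      \<open>W p \<le> m p\<close>.\<close>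
    moreover from this have "(1 - fst p) * (1 - snd p) \<ge> 0"
      by simp
    ultimately show "m p \<le> M p" "W p \<le> m p" "c p \<le> M p" "W p \<le> c p"
      using copula_Frechet_bounds[OF assms, of "fst p" "snd p"]
      by (auto simp: c_def m_def M_def W_def algebra_simps mult_left_le mult_left_le_one_le)
  qed
  have vals: "integral S m = 1 / 4" "integral S M = 1 / 3" "integral S W = 1 / 6"
    using integral_product_unit_square integral_upper_Frechet_bound integral_lower_Frechet_bound
    by (simp_all add: S_def m_def M_def W_def)
  \<comment> \<open>Twice the positive part of \<open>c - m\<close> is at most
    \<open>2 * (M - m)\<close>; adding \<open>m\<close> to both sides gives this form. The right
    side integrates to 2/3 - 1/4.\<close>
  have "integral S (\<lambda>p. \<bar>c p - m p\<bar> + c p) \<le> integral S (\<lambda>p. M p + M p - m p)"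
    proof (intro integral_le int continuous_intros)
    show "\<bar>c p - m p\<bar> + c p \<le> M p + M p - m p" if "p \<in> S" for p
      using pt[OF that] by linarith
  qed
  then have upper: "integral S (\<lambda>p. \<bar>c p - m p\<bar>) + integral S c \<le> 5 / 12"
    by (simp add: integral_add integral_diff int continuous_intros vals)
  \<comment> \<open>Likewise with the negative part, bounded by \<open>m - W\<close>; the right side
    integrates to 1/4 - 1/3.\<close>
  have "integral S (\<lambda>p. \<bar>c p - m p\<bar> - c p) \<le> integral S (\<lambda>p. m p - (W p + W p))"
    proof (intro integral_le int continuous_intros)
    show "\<bar>c p - m p\<bar> - c p \<le> m p - (W p + W p)" if "p \<in> S" for p
      using pt[OF that] by linarith
  qed
  then have lower: "integral S (\<lambda>p. \<bar>c p - m p\<bar>) - integral S c \<le> - 1 / 12"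
    by (simp add: integral_add integral_diff int continuous_intros vals)
  \<comment> \<open>Multiplied by 12, the two estimates bound \<open>sigma1 C\<close> by
    \<open>2 - spearman_rho C\<close> and by \<open>2 + spearman_rho C\<close>.\<close>
  from upper lower have "sigma1 C \<le> 2 - \<bar>spearman_rho C\<bar>"
    unfolding sigma rho by linarith
  with first show ?thesis
    by simp
qed

end
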